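(* Let $d\ge1$, let $\{\mathbf{Y}_n\}_{n\ge 0}$ be an $\mathcal{S}_d$-valued supermartingale with respect to a filtration $\{\mathcal{F}_n\}_{n\ge 0}$, and let $\sigma\le\tau$ be two stopping times with respect to $\{\mathcal{F}_n\}$. Then: (1) $\{\mathbf{Y}_{n\wedge\tau}\}_{n\ge 0}$ is a supermartingale with respect to both $\{\mathcal{F}_n\}_{n\ge0}$ and $\{\mathcal{F}_{n\wedge\tau}\}_{n\ge0}$. (2) If either (a) $\tau<N$ for some finite $N$, or (b) $\tau<\infty$ and $\{\mathbf{Y}_n\}$ is $\mathcal{S}_d^{+}$-valued, then $\mathbb{E}(\mathbf{Y}_\tau\mid\mathcal{F}_\sigma)\preceq\mathbf{Y}_\sigma$ almost surely. Consequently $\mathbb{E}\,\mathbf{Y}_\tau\preceq\mathbb{E}\,\mathbf{Y}_\sigma\preceq\mathbb{E}\,\mathbf{Y}_0$.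
   Context: $\mathcal{S}_d$ is the set of real symmetric $d\times d$ matrices and $\mathcal{S}_d^{+}$ the subset of positive semidefinite ones. $\preceq$ is the Loewner order: $\mathbf{A}\preceq\mathbf{B}$ iff $\mathbf{B}-\mathbf{A}$ is positive semidefinite. Expectations and conditional expectations of random matrices are entrywise. An $\mathcal{S}_d$-valued (integrable) process $\{\mathbf{Y}_n\}_{n\ge 0}$ adapted to a filtration $\{\mathcal{F}_n\}_{n\ge 0}$ is a supermartingale if $\mathbb{E}(\mathbf{Y}_n\mid\mathcal{F}_{n-1})\preceq\mathbf{Y}_{n-1}$ almost surely for all $n\ge 1$. $\mathcal{F}_\sigma$ denotes the usual stopped $\sigma$-algebra. *)

theory Defs
  imports "HOL-Probability.Probability"
begin

text \<open>The order \<open>\<le>\<close> that the library puts on \<open>real ^ 'd ^ 'd\<close> is the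
  componentwise one, so the Loewner order gets its own symbol.\<close>

definition sym_matrices :: "(real ^ 'd ^ 'd) set" where
  "sym_matrices = {A. transpose A = A}"

definition psd_matrices :: "(real ^ 'd ^ 'd) set" where
  "psd_matrices = {A \<in> sym_matrices. \<forall>x. 0 \<le> x \<bullet> (A *v x)}"

definition loewner_le :: "real ^ 'd ^ 'd \<Rightarrow> real ^ 'd ^ 'd \<Rightarrow> bool"  (infix "\<preceq>\<^sub>L" 50) where
  "A \<preceq>\<^sub>L B \<longleftrightarrow> B - A \<in> psd_matrices"

definition mat_integrable :: "'a measure \<Rightarrow> ('a \<Rightarrow> real ^ 'd ^ 'd) \<Rightarrow> bool" where
  "mat_integrable M X \<longleftrightarrow> (\<forall>i j. integrable M (\<lambda>\<omega>. X \<omega> $ i $ j))"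

definition mat_expectation :: "'a measure \<Rightarrow> ('a \<Rightarrow> real ^ 'd ^ 'd) \<Rightarrow> real ^ 'd ^ 'd" where
  "mat_expectation M X = (\<chi> i j. integral\<^sup>L M (\<lambda>\<omega>. X \<omega> $ i $ j))"

definition mat_cond_exp ::
    "'a measure \<Rightarrow> 'a measure \<Rightarrow> ('a \<Rightarrow> real ^ 'd ^ 'd) \<Rightarrow> 'a \<Rightarrow> real ^ 'd ^ 'd" where
  "mat_cond_exp M G X \<omega> = (\<chi> i j. real_cond_exp M G (\<lambda>\<omega>'. X \<omega>' $ i $ j) \<omega>)"

definition mat_supermartingale ::
    "'a measure \<Rightarrow> (nat \<Rightarrow> 'a measure) \<Rightarrow> (nat \<Rightarrow> 'a \<Rightarrow> real ^ 'd ^ 'd) \<Rightarrow> bool" where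
  "mat_supermartingale M F Y \<longleftrightarrow>
     filtration (space M) F \<and> (\<forall>n. subalgebra M (F n)) \<and>
     (\<forall>n. \<forall>\<omega>\<in>space M. Y n \<omega> \<in> sym_matrices) \<and>
     (\<forall>n. Y n \<in> borel_measurable (F n)) \<and>
     (\<forall>n. mat_integrable M (Y n)) \<and>
     (\<forall>n. AE \<omega> in M. mat_cond_exp M (F n) (Y (Suc n)) \<omega> \<preceq>\<^sub>L Y n \<omega>)"

text \<open>The library's stopping times take values in the index type of the filtration.
  Stopping times with values in \<open>{0, 1, ..., \<infinity>}\<close> are obtained by extending a filtration
  over \<^typ>\<open>nat\<close> to \<^typ>\<open>enat\<close>, the \<open>\<sigma>\<close>-algebra at \<open>\<infinity>\<close> being generated by all the others;
  the condition at \<open>t = \<infinity>\<close> in \<^const>\<open>stopping_time\<close> is then vacuous.\<close>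

definition ext_filt :: "(nat \<Rightarrow> 'a measure) \<Rightarrow> enat \<Rightarrow> 'a measure" where
  "ext_filt F t = (case t of enat n \<Rightarrow> F n | \<infinity> \<Rightarrow> sigma (space (F 0)) (\<Union>n. sets (F n)))"

abbreviation nat_stopping_time :: "(nat \<Rightarrow> 'a measure) \<Rightarrow> ('a \<Rightarrow> enat) \<Rightarrow> bool" where
  "nat_stopping_time F T \<equiv> stopping_time (ext_filt F) T"

definition stopped_sigma :: "(nat \<Rightarrow> 'a measure) \<Rightarrow> ('a \<Rightarrow> enat) \<Rightarrow> 'a measure" where
  "stopped_sigma F T = filtration.pre_sigma (space (F 0)) (ext_filt F) T"

text \<open>The process \<open>Y\<close> at the random time \<open>T\<close>. The value 0 where \<open>T = \<infinity>\<close> is a convention;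
  it is immaterial for almost surely finite \<open>T\<close>.\<close>

definition at_time :: "(nat \<Rightarrow> 'a \<Rightarrow> 'b::zero) \<Rightarrow> ('a \<Rightarrow> enat) \<Rightarrow> 'a \<Rightarrow> 'b" where
  "at_time Y T \<omega> = (case T \<omega> of enat n \<Rightarrow> Y n \<omega> | \<infinity> \<Rightarrow> 0)"

lemma filtration_ext_filt:
  assumes "filtration \<Omega> F"
  shows "filtration \<Omega> (ext_filt F)"
proof
  interpret filtration \<Omega> F by fact
  have sub: "(\<Union>n. sets (F n)) \<subseteq> Pow \<Omega>"
    using sets.sets_into_space space_F by fastforce
  show "space (ext_filt F i) = \<Omega>" for i
    using sub by (cases i) (simp_all add: ext_filt_def space_F)
  show "sets (ext_filt F i) \<subseteq> sets (ext_filt F j)" if "i \<le> j" for i j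
    using that sub sets_F_mono
    by (cases i; cases j) (auto simp: ext_filt_def space_F)
qed

lemma nat_stopping_time_iff:
  assumes "filtration \<Omega> F"
  shows "nat_stopping_time F T \<longleftrightarrow> (\<forall>n. {\<omega> \<in> \<Omega>. T \<omega> \<le> enat n} \<in> sets (F n))"
proof -
  interpret filtration \<Omega> F by fact
  have all: "(\<forall>t. P t) \<longleftrightarrow> (\<forall>n. P (enat n)) \<and> P \<infinity>" for P
    by (metis enat.exhaust)
  show ?thesis
    unfolding stopping_time_def all by (simp add: ext_filt_def pred_def space_F)
qed

lemma sets_stopped_sigma:
  assumes "filtration \<Omega> F" "nat_stopping_time F T"
  shows "sets (stopped_sigma F T) =
    {A \<in> sigma_sets \<Omega> (\<Union>n. sets (F n)). \<forall>n. {\<omega> \<in> A. T \<omega> \<le> enat n} \<in> sets (F n)}"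
proof -
  interpret filtration \<Omega> F by fact
  interpret E: filtration \<Omega> "ext_filt F" by (rule filtration_ext_filt) fact
  have sub: "(\<Union>n. sets (F n)) \<subseteq> Pow \<Omega>"
    using sets.sets_into_space space_F by fastforce
  have all: "(\<forall>t. P t) \<longleftrightarrow> (\<forall>n. P (enat n)) \<and> P \<infinity>" for P
    by (metis enat.exhaust)
  show ?thesis
    unfolding stopped_sigma_def space_F E.sets_pre_sigma[OF assms(2)] all
    using sub by (auto simp: ext_filt_def space_F)
qed

end

theory Submission
  imports Defs
begin

text \<open>The Loewner order is tested by the quadratic forms \<open>x \<bullet> (A *v x)\<close>, and a countable dense
  set of vectors \<open>x\<close> suffices, so almost sure Loewner inequalities between conditional
  expectations amount to inequalities between integrals of these forms over the sets of the
  conditioning \<open>\<sigma>\<close>-algebra. For a real supermartingale \<open>y\<close> and \<open>S \<le> T\<close>, the difference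
  \<open>y\<^bsub>T \<and> N\<^esub> - y\<^bsub>S \<and> N\<^esub>\<close> is the sum over \<open>n < N\<close> of the increments \<open>y\<^bsub>n+1\<^esub> - y\<^bsub>n\<^esub>\<close>
  restricted to \<open>{S \<le> n < T}\<close>, so its integral over any set of the stopped \<open>\<sigma>\<close>-algebra at \<open>S\<close> is
  nonpositive. If \<open>T\<close> is bounded this is already optional stopping; for nonnegative \<open>y\<close> one lets
  \<open>N\<close> tend to infinity on \<open>{S \<le> k}\<close>, where \<open>y\<^bsub>S \<and> N\<^esub>\<close> is eventually constant, by Fatou's
  lemma.\<close>

subsection \<open>Stopped \<open>\<sigma>\<close>-algebras\<close>

text \<open>Fixes the index set to be the natural numbers: discrete time is what makes the events
  \<open>T = k\<close> measurable and lets stopped processes be handled by induction.\<close>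

locale nat_filtration = filtration \<Omega> F for \<Omega> :: "'a set" and F :: "nat \<Rightarrow> 'a measure"
begin

lemma stopping_time_le_sets:
  assumes "nat_stopping_time F T" "k \<le> n"
  shows "{\<omega> \<in> \<Omega>. T \<omega> \<le> enat k} \<in> sets (F n)"
  using assms sets_F_mono nat_stopping_time_iff[OF filtration_axioms] by blast

lemma stopping_time_gt_sets:
  assumes "nat_stopping_time F T" "k \<le> n"
  shows "{\<omega> \<in> \<Omega>. enat k < T \<omega>} \<in> sets (F n)"
proof -
  have "{\<omega> \<in> \<Omega>. enat k < T \<omega>} = space (F n) - {\<omega> \<in> \<Omega>. T \<omega> \<le> enat k}"
    by (auto simp: space_F)
  then show ?thesis
    using stopping_time_le_sets[OF assms] by auto
qed

lemma stopping_time_eq_sets: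
  assumes T: "nat_stopping_time F T" and "k \<le> n"
  shows "{\<omega> \<in> \<Omega>. T \<omega> = enat k} \<in> sets (F n)"
proof -
  have "{\<omega> \<in> \<Omega>. T \<omega> = enat k} =
      {\<omega> \<in> \<Omega>. T \<omega> \<le> enat k} - (\<Union>j<k. {\<omega> \<in> \<Omega>. T \<omega> \<le> enat j})"
  proof (intro set_eqI)
    show "\<omega> \<in> {\<omega> \<in> \<Omega>. T \<omega> = enat k} \<longleftrightarrow>
        \<omega> \<in> {\<omega> \<in> \<Omega>. T \<omega> \<le> enat k} - (\<Union>j<k. {\<omega> \<in> \<Omega>. T \<omega> \<le> enat j})" for \<omega>
    proof (cases "T \<omega>")
      case (enat m)
      have "m = k \<longleftrightarrow> m \<le> k \<and> (\<forall>j<k. \<not> m \<le> j)"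
        by (metis le_eq_less_or_eq le_refl not_le)
      then show ?thesis
        by (auto simp: enat)
    qed simp
  qed
  also have "\<dots> \<in> sets (F n)"
    using stopping_time_le_sets[OF T] \<open>k \<le> n\<close> by (intro sets.Diff sets.finite_UN) auto
  finally show ?thesis .
qed

lemma stopping_time_min_enat:
  "nat_stopping_time F T \<Longrightarrow> nat_stopping_time F (\<lambda>\<omega>. min (enat n) (T \<omega>))"
  by (intro stopping_time_min stopping_time_const)

lemma space_stopped_sigma: "space (stopped_sigma F T) = \<Omega>"
  unfolding stopped_sigma_def space_F
  by (rule filtration.space_pre_sigma[OF filtration_ext_filt[OF filtration_axioms]])

lemma UN_sets_subset: "(\<Union>n. sets (F n)) \<subseteq> Pow \<Omega>"
  using sets.sets_into_space space_F by fastforce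

lemma stopped_sigma_mono:
  assumes S: "nat_stopping_time F S" and T: "nat_stopping_time F T"
    and le: "\<And>\<omega>. \<omega> \<in> \<Omega> \<Longrightarrow> S \<omega> \<le> T \<omega>"
  shows "sets (stopped_sigma F S) \<subseteq> sets (stopped_sigma F T)"
proof
  fix A assume A: "A \<in> sets (stopped_sigma F S)"
  then have "A \<subseteq> \<Omega>"
    using sets.sets_into_space space_stopped_sigma by blast
  \<comment> \<open>Since \<open>S\<close> is below \<open>T\<close>, the event
    \<open>T \<le> n\<close> already forces \<open>S \<le> n\<close>, so the cut at \<open>n\<close>
    can be made with \<open>S\<close> first.\<close>
  have "{\<omega> \<in> A. T \<omega> \<le> enat n} = {\<omega> \<in> A. S \<omega> \<le> enat n} \<inter> {\<omega> \<in> \<Omega>. T \<omega> \<le> enat n}" for n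
    using le \<open>A \<subseteq> \<Omega>\<close> by (auto intro: order_trans)
  then show "A \<in> sets (stopped_sigma F T)"
    using A stopping_time_le_sets[OF T]
    unfolding sets_stopped_sigma[OF filtration_axioms S] sets_stopped_sigma[OF filtration_axioms T]
    by auto
qed

text \<open>The truncated time never exceeds \<open>n\<close>, so cutting \<open>A\<close> at time
  \<open>n\<close> leaves all of \<open>A\<close>.\<close>

lemma stopped_sigma_min_subset:
  assumes "nat_stopping_time F T"
  shows "sets (stopped_sigma F (\<lambda>\<omega>. min (enat n) (T \<omega>))) \<subseteq> sets (F n)"
proof
  fix A assume "A \<in> sets (stopped_sigma F (\<lambda>\<omega>. min (enat n) (T \<omega>)))"
  then have "{\<omega> \<in> A. min (enat n) (T \<omega>) \<le> enat n} \<in> sets (F n)"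
    unfolding sets_stopped_sigma[OF filtration_axioms stopping_time_min_enat[OF assms]] by blast
  then show "A \<in> sets (F n)"
    by simp
qed

lemma filtration_stopped_sigma:
  assumes "nat_stopping_time F T"
  shows "filtration \<Omega> (\<lambda>n. stopped_sigma F (\<lambda>\<omega>. min (enat n) (T \<omega>)))"
proof
  show "sets (stopped_sigma F (\<lambda>\<omega>. min (enat m) (T \<omega>))) \<subseteq>
      sets (stopped_sigma F (\<lambda>\<omega>. min (enat n) (T \<omega>)))" if "m \<le> n" for m n
    using that by (intro stopped_sigma_mono stopping_time_min_enat assms min.mono) auto
qed (rule space_stopped_sigma)

lemma subalgebra_stopped_sigma:
  assumes "\<And>n. subalgebra M (F n)" "nat_stopping_time F T"
  shows "subalgebra M (stopped_sigma F T)"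
proof -
  have "space M = \<Omega>"
    using assms(1)[of 0] by (simp add: subalgebra_def space_F)
  moreover have "sigma_sets (space M) (\<Union>n. sets (F n)) \<subseteq> sets M"
    using assms(1) by (intro sets.sigma_sets_subset) (auto simp: subalgebra_def)
  ultimately show ?thesis
    by (auto simp: subalgebra_def space_stopped_sigma
        sets_stopped_sigma[OF filtration_axioms assms(2)])
qed

text \<open>A preimage is split according to the value of \<open>T\<close>. On \<open>T = k\<close>
  the stopped variable is \<open>Y k\<close>, so that piece lies in \<open>F k\<close>, hence in
  every later \<open>F n\<close>. Only finitely many pieces meet the event
  \<open>T \<le> n\<close>.\<close>

lemma measurable_at_time:
  fixes Y :: "nat \<Rightarrow> 'a \<Rightarrow> 'b::{zero,topological_space}"
  assumes T: "nat_stopping_time F T" and Y: "\<And>n. Y n \<in> borel_measurable (F n)"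
  shows "at_time Y T \<in> borel_measurable (stopped_sigma F T)"
proof (rule measurableI)
  fix B :: "'b set" assume B: "B \<in> sets borel"
  define E where "E k = {\<omega> \<in> \<Omega>. T \<omega> = enat k} \<inter> (Y k -` B \<inter> space (F k))" for k
  have E: "E k \<in> sets (F n)" if "k \<le> n" for k n
    using sets_F_mono[OF that] measurable_sets[OF Y B, of k] stopping_time_eq_sets[OF T that]
    unfolding E_def by auto
  have E': "E k \<in> sigma_sets \<Omega> (\<Union>n. sets (F n))" for k
    using E[of k k] by blast
  \<comment> \<open>This is the event that \<open>T\<close> is infinite. There the stopped variable
    is 0 by convention, so the event lies in the preimage of \<open>B\<close> either entirely or not
    at all.\<close>
  define I where "I = \<Omega> - (\<Union>k. {\<omega> \<in> \<Omega>. T \<omega> = enat k})"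
  interpret sigma_algebra \<Omega> "sigma_sets \<Omega> (\<Union>n. sets (F n))"
    by (rule sigma_algebra_sigma_sets[OF UN_sets_subset])
  have I: "I \<in> sigma_sets \<Omega> (\<Union>n. sets (F n))"
    unfolding I_def using stopping_time_eq_sets[OF T order_refl]
    by (intro compl_sets countable_UN) auto
  have eq: "at_time Y T -` B \<inter> \<Omega> = (\<Union>k. E k) \<union> (if 0 \<in> B then I else {})"
  proof (intro set_eqI)
    show "\<omega> \<in> at_time Y T -` B \<inter> \<Omega> \<longleftrightarrow> \<omega> \<in> (\<Union>k. E k) \<union> (if 0 \<in> B then I else {})" for \<omega>
      by (cases "T \<omega>") (auto simp: at_time_def E_def I_def space_F)
  qed
  have "at_time Y T -` B \<inter> \<Omega> \<in> sigma_sets \<Omega> (\<Union>n. sets (F n))"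
    unfolding eq using I E' by (intro Un countable_UN) auto
  moreover have "{\<omega> \<in> at_time Y T -` B \<inter> \<Omega>. T \<omega> \<le> enat n} \<in> sets (F n)" for n
  proof -
    have "{\<omega> \<in> at_time Y T -` B \<inter> \<Omega>. T \<omega> \<le> enat n} = (\<Union>k\<le>n. E k)"
    proof (intro set_eqI)
      show "\<omega> \<in> {\<omega> \<in> at_time Y T -` B \<inter> \<Omega>. T \<omega> \<le> enat n} \<longleftrightarrow> \<omega> \<in> (\<Union>k\<le>n. E k)" for \<omega>
        by (cases "T \<omega>") (auto simp: at_time_def E_def space_F)
    qed
    also have "\<dots> \<in> sets (F n)"
      using E by (intro sets.finite_UN) auto
    finally show ?thesis .
  qed
  ultimately show "at_time Y T -` B \<inter> space (stopped_sigma F T) \<in> sets (stopped_sigma F T)"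
    unfolding sets_stopped_sigma[OF filtration_axioms T] space_stopped_sigma by blast
qed auto

end

section \<open>Pointwise behaviour of stopped processes\<close>

lemma at_time_compose: "f 0 = 0 \<Longrightarrow> at_time (\<lambda>n \<omega>. f (Y n \<omega>)) T \<omega> = f (at_time Y T \<omega>)"
  by (simp add: at_time_def split: enat.split)

text \<open>The stopped process moves between \<open>n\<close> and \<open>n + 1\<close> only where
  \<open>T\<close> has not yet occurred, an event known at time \<open>n\<close>. All later
  inductions rest on this increment formula.\<close>

lemma at_time_min_Suc:
  fixes y :: "nat \<Rightarrow> 'a \<Rightarrow> real"
  shows "at_time y (\<lambda>\<omega>. min (enat (Suc n)) (T \<omega>)) \<omega> =
    at_time y (\<lambda>\<omega>. min (enat n) (T \<omega>)) \<omega> + of_bool (enat n < T \<omega>) * (y (Suc n) \<omega> - y n \<omega>)"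
proof (cases "T \<omega>")
  case (enat k)
  consider "k \<le> n" | "n < k" by linarith
  then show ?thesis
    by cases (auto simp: at_time_def enat min_def)
qed (simp add: at_time_def)

lemma at_time_min_eq: "T \<omega> \<le> enat n \<Longrightarrow> at_time y (\<lambda>\<omega>. min (enat n) (T \<omega>)) \<omega> = at_time y T \<omega>"
  by (simp add: at_time_def min_absorb2)

text \<open>The sequence is constant once \<open>n + k\<close> has reached the finite value of
  \<open>T\<close>. The offset \<open>k\<close> allows truncations that start late enough to leave
  another, smaller time untouched.\<close>

lemma at_time_min_tendsto:
  assumes "T \<omega> < \<infinity>"
  shows "(\<lambda>n. at_time y (\<lambda>\<omega>. min (enat (n + k)) (T \<omega>)) \<omega>) \<longlonglongrightarrow> at_time y T \<omega>"
proof -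
  obtain m where m: "T \<omega> = enat m"
    using assms by auto
  have "\<forall>\<^sub>F n in sequentially. at_time y (\<lambda>\<omega>. min (enat (n + k)) (T \<omega>)) \<omega> = at_time y T \<omega>"
    using eventually_ge_at_top[of m] by eventually_elim (intro at_time_min_eq, simp add: m)
  then show ?thesis
    by (rule tendsto_eventually)
qed

subsection \<open>Optional stopping for real supermartingales\<close>

text \<open>Fatou's lemma. The uniform bound \<open>C\<close> on the integrals replaces a dominating
  function and yields integrability of the limit as well.\<close>

lemma integral_le_of_AE_tendsto_nonneg:
  fixes f :: "nat \<Rightarrow> 'a \<Rightarrow> real"
  assumes int: "\<And>n. integrable M (f n)" and nonneg: "\<And>n. AE \<omega> in M. 0 \<le> f n \<omega>"
    and le: "\<And>n. integral\<^sup>L M (f n) \<le> C"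
    and lim: "AE \<omega> in M. (\<lambda>n. f n \<omega>) \<longlonglongrightarrow> g \<omega>" and meas: "g \<in> borel_measurable M"
  shows "integrable M g" "integral\<^sup>L M g \<le> C"
proof -
  \<comment> \<open>\<open>ennreal\<close> sends negative reals to 0, so this is what allows the
    final bound to be read back in the reals.\<close>
  have C: "0 \<le> C"
    using integral_nonneg_AE[OF nonneg] le order_trans by blast
  have "AE \<omega> in M. \<forall>n. 0 \<le> f n \<omega>"
    using nonneg by (simp add: AE_all_countable)
  with lim have g: "AE \<omega> in M. 0 \<le> g \<omega>"
    by eventually_elim (auto intro: LIMSEQ_le_const)
  have "(\<integral>\<^sup>+\<omega>. ennreal (g \<omega>) \<partial>M) = (\<integral>\<^sup>+\<omega>. liminf (\<lambda>n. ennreal (f n \<omega>)) \<partial>M)"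
    using lim by (intro nn_integral_cong_AE, eventually_elim)
      (metis lim_imp_Liminf sequentially_bot tendsto_ennrealI)
  also have "\<dots> \<le> liminf (\<lambda>n. \<integral>\<^sup>+\<omega>. ennreal (f n \<omega>) \<partial>M)"
    using int by (intro nn_integral_liminf) auto
  also have "\<dots> \<le> liminf (\<lambda>n::nat. ennreal C)"
    using le by (intro Liminf_mono always_eventually allI)
      (auto simp: nn_integral_eq_integral[OF int nonneg] intro: ennreal_leI)
  finally have *: "(\<integral>\<^sup>+\<omega>. ennreal (g \<omega>) \<partial>M) \<le> ennreal C"
    by (simp add: Liminf_const)
  then show **: "integrable M g"
    using g meas by (intro integrableI_nonneg) (auto intro: le_less_trans)
  show "integral\<^sup>L M g \<le> C"
    using * C by (simp add: nn_integral_eq_integral[OF ** g])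
qed

text \<open>One direction integrates the inequality over \<open>A\<close> and uses the averaging
  property of conditional expectation; the other tests the integrals on the very set where the
  inequality fails.\<close>

lemma (in sigma_finite_subalgebra) real_cond_exp_le_iff:
  assumes f: "integrable M f" and g: "integrable M g" "g \<in> borel_measurable F"
  shows "(AE x in M. real_cond_exp M F f x \<le> g x) \<longleftrightarrow>
    (\<forall>A\<in>sets F. (\<integral>x\<in>A. f x \<partial>M) \<le> (\<integral>x\<in>A. g x \<partial>M))"
proof safe
  fix A assume le: "AE x in M. real_cond_exp M F f x \<le> g x" and A: "A \<in> sets F"
  then have "A \<in> sets M"
    using subalg by (auto simp: subalgebra_def)
  then have "(\<integral>x\<in>A. real_cond_exp M F f x \<partial>M) \<le> (\<integral>x\<in>A. g x \<partial>M)"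
    unfolding set_lebesgue_integral_def using le
    by (intro integral_mono_AE integrable_mult_indicator real_cond_exp_int f g)
      (auto split: split_indicator)
  then show "(\<integral>x\<in>A. f x \<partial>M) \<le> (\<integral>x\<in>A. g x \<partial>M)"
    by (simp add: real_cond_exp_intA[OF f A])
next
  assume le: "\<forall>A\<in>sets F. (\<integral>x\<in>A. f x \<partial>M) \<le> (\<integral>x\<in>A. g x \<partial>M)"
  define A where "A = {x \<in> space F. g x < real_cond_exp M F f x}"
  have A: "A \<in> sets F"
    unfolding A_def using g by measurable
  have AM: "A \<in> sets M" and sp: "space F = space M"
    using A subalg by (auto simp: subalgebra_def)
  let ?h = "\<lambda>x. indicator A x *\<^sub>R real_cond_exp M F f x - indicator A x *\<^sub>R g x"
  have int: "integrable M (\<lambda>x. indicator A x *\<^sub>R real_cond_exp M F f x)"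
    "integrable M (\<lambda>x. indicator A x *\<^sub>R g x)"
    by (intro integrable_mult_indicator AM real_cond_exp_int f g)+
  have "integral\<^sup>L M ?h = (\<integral>x\<in>A. f x \<partial>M) - (\<integral>x\<in>A. g x \<partial>M)"
    unfolding real_cond_exp_intA[OF f A] using int by (simp add: set_lebesgue_integral_def)
  then have "integral\<^sup>L M ?h \<le> 0"
    using le A by auto
  \<comment> \<open>On \<open>A\<close> the function is strictly positive and elsewhere it vanishes.
    An integral that is at most 0 therefore makes \<open>A\<close> a null set.\<close>
  moreover have nonneg: "AE x in M. 0 \<le> ?h x"
    by (intro AE_I2) (auto simp: A_def split: split_indicator)
  ultimately have "integral\<^sup>L M ?h = 0"
    using integral_nonneg_AE[OF nonneg] by linarith
  then have "AE x in M. ?h x = 0"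
    using integral_nonneg_eq_0_iff_AE[OF _ nonneg] int by simp
  then show "AE x in M. real_cond_exp M F f x \<le> g x"
    using AE_space by eventually_elim (auto simp: A_def sp not_le split: split_indicator_asm)
qed

text \<open>The supermartingale property is stated through integrals over sets of
  \<open>F n\<close>, which are additive and survive restriction to stopping events; conditional
  expectations do not appear in the stopping arguments.\<close>

locale real_supermartingale =
  prob_space M + nat_filtration "space M" F
  for M :: "'a measure" and F :: "nat \<Rightarrow> 'a measure" +
  fixes y :: "nat \<Rightarrow> 'a \<Rightarrow> real"
  assumes subalgebra: "\<And>n. subalgebra M (F n)"
    and adapted: "\<And>n. y n \<in> borel_measurable (F n)"
    and integrable: "\<And>n. integrable M (y n)"
    and set_integral_Suc_le:
      "\<And>n A. A \<in> sets (F n) \<Longrightarrow> (\<integral>\<omega>\<in>A. y (Suc n) \<omega> \<partial>M) \<le> (\<integral>\<omega>\<in>A. y n \<omega> \<partial>M)"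
begin

lemma sets_F_subset: "sets (F n) \<subseteq> sets M"
  using subalgebra by (auto simp: subalgebra_def)

lemma integral_increment_le_0:
  assumes "A \<in> sets (F n)"
  shows "integrable M (\<lambda>\<omega>. indicator A \<omega> * (y (Suc n) \<omega> - y n \<omega>))"
    and "(\<integral>\<omega>. indicator A \<omega> * (y (Suc n) \<omega> - y n \<omega>) \<partial>M) \<le> 0"
proof -
  have *: "integrable M (\<lambda>\<omega>. indicator A \<omega> * y k \<omega>)" for k
    using integrable_mult_indicator[OF _ integrable, of A k] assms sets_F_subset by auto
  then show "integrable M (\<lambda>\<omega>. indicator A \<omega> * (y (Suc n) \<omega> - y n \<omega>))"
    by (simp add: right_diff_distrib)
  show "(\<integral>\<omega>. indicator A \<omega> * (y (Suc n) \<omega> - y n \<omega>) \<partial>M) \<le> 0"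
    using set_integral_Suc_le[OF assms] *
    by (simp add: right_diff_distrib set_lebesgue_integral_def)
qed

lemma integrable_stopped:
  assumes T: "nat_stopping_time F T"
  shows "integrable M (at_time y (\<lambda>\<omega>. min (enat n) (T \<omega>)))"
proof (induction n)
  case 0
  have "at_time y (\<lambda>\<omega>. min (enat 0) (T \<omega>)) = y 0"
    by (simp add: fun_eq_iff at_time_def zero_enat_def[symmetric])
       (simp add: zero_enat_def)
  then show ?case
    by (simp add: integrable)
next
  case (Suc n)
  have "integrable M (\<lambda>\<omega>. at_time y (\<lambda>\<omega>. min (enat n) (T \<omega>)) \<omega> +
      indicator {\<omega> \<in> space M. enat n < T \<omega>} \<omega> * (y (Suc n) \<omega> - y n \<omega>))"
    by (intro Bochner_Integration.integrable_add Suc integral_increment_le_0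
        stopping_time_gt_sets[OF T order_refl])
  then show ?case
    by (rule Bochner_Integration.integrable_cong[THEN iffD1, rotated 2])
       (auto simp: at_time_min_Suc)
qed

lemma integrable_indicator_stopped:
  assumes "nat_stopping_time F T" "A \<in> sets M"
  shows "integrable M (\<lambda>\<omega>. indicator A \<omega> * at_time y (\<lambda>\<omega>. min (enat n) (T \<omega>)) \<omega>)"
  using integrable_mult_indicator[OF assms(2) integrable_stopped[OF assms(1)]] by simp

text \<open>The increment over \<open>A\<close> lives on the part of \<open>A\<close> where
  \<open>n < T\<close>, which is again a set of \<open>F n\<close>.\<close>

lemma set_integral_stopped_Suc_le:
  assumes T: "nat_stopping_time F T" and A: "A \<in> sets (F n)"
  shows "(\<integral>\<omega>\<in>A. at_time y (\<lambda>\<omega>. min (enat (Suc n)) (T \<omega>)) \<omega> \<partial>M) \<le>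
    (\<integral>\<omega>\<in>A. at_time y (\<lambda>\<omega>. min (enat n) (T \<omega>)) \<omega> \<partial>M)"
proof -
  let ?B = "A \<inter> {\<omega> \<in> space M. enat n < T \<omega>}"
  have B: "?B \<in> sets (F n)"
    using A stopping_time_gt_sets[OF T order_refl] by auto
  have AM: "A \<in> sets M"
    using A sets_F_subset by auto
  have "(\<integral>\<omega>. indicator A \<omega> * at_time y (\<lambda>\<omega>. min (enat (Suc n)) (T \<omega>)) \<omega> \<partial>M) =
      (\<integral>\<omega>. indicator A \<omega> * at_time y (\<lambda>\<omega>. min (enat n) (T \<omega>)) \<omega> +
        indicator ?B \<omega> * (y (Suc n) \<omega> - y n \<omega>) \<partial>M)"
    by (intro Bochner_Integration.integral_cong) (auto simp: at_time_min_Suc split: split_indicator)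
  also have "\<dots> \<le> (\<integral>\<omega>. indicator A \<omega> * at_time y (\<lambda>\<omega>. min (enat n) (T \<omega>)) \<omega> \<partial>M)"
    using integral_increment_le_0[OF B] integrable_indicator_stopped[OF T AM] by simp
  finally show ?thesis
    by (simp add: set_lebesgue_integral_def)
qed

lemma subalgebra_stopped: "nat_stopping_time F T \<Longrightarrow> subalgebra M (stopped_sigma F T)"
  by (rule subalgebra_stopped_sigma[OF subalgebra])

lemma measurable_stopped:
  assumes "nat_stopping_time F T"
  shows "at_time y T \<in> borel_measurable M"
  using measurable_from_subalg[OF subalgebra_stopped[OF assms] measurable_at_time[OF assms adapted]] .

context
  fixes S T :: "'a \<Rightarrow> enat"
  assumes S: "nat_stopping_time F S" and T: "nat_stopping_time F T"
    and S_le_T: "\<And>\<omega>. \<omega> \<in> space M \<Longrightarrow> S \<omega> \<le> T \<omega>"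
begin

lemma integral_truncated_le:
  assumes A: "A \<in> sets (stopped_sigma F S)"
  shows "(\<integral>\<omega>. indicator A \<omega> * at_time y (\<lambda>\<omega>. min (enat N) (T \<omega>)) \<omega> \<partial>M) \<le>
    (\<integral>\<omega>. indicator A \<omega> * at_time y (\<lambda>\<omega>. min (enat N) (S \<omega>)) \<omega> \<partial>M)"
proof -
  have AM: "A \<in> sets M"
    using A subalgebra_stopped[OF S] by (auto simp: subalgebra_def)
  let ?d = "\<lambda>N \<omega>. indicator A \<omega> * at_time y (\<lambda>\<omega>. min (enat N) (T \<omega>)) \<omega> -
    indicator A \<omega> * at_time y (\<lambda>\<omega>. min (enat N) (S \<omega>)) \<omega>"
  have int: "integrable M (?d N)" for N
    using integrable_indicator_stopped[OF S AM] integrable_indicator_stopped[OF T AM] by simp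
  have "integral\<^sup>L M (?d N) \<le> 0"
  proof (induction N)
    case 0
    then show ?case
      by (simp add: at_time_def zero_enat_def[symmetric])
  next
    case (Suc N)
    \<comment> \<open>The two truncated processes make different moves at step \<open>N\<close> only
      when \<open>S\<close> has occurred and \<open>T\<close> has not. That \<open>A\<close> belongs
      to the stopped \<sigma>-algebra at \<open>S\<close> is exactly what puts its part with
      \<open>S \<le> N\<close> into \<open>F N\<close>.\<close>
    let ?B = "{\<omega> \<in> A. S \<omega> \<le> enat N} \<inter> {\<omega> \<in> space M. enat N < T \<omega>}"
    have B: "?B \<in> sets (F N)"
      using A stopping_time_gt_sets[OF T order_refl]
      unfolding sets_stopped_sigma[OF filtration_axioms S] by auto
    have "integral\<^sup>L M (?d (Suc N)) =
        (\<integral>\<omega>. ?d N \<omega> + indicator ?B \<omega> * (y (Suc N) \<omega> - y N \<omega>) \<partial>M)"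
    proof (intro Bochner_Integration.integral_cong refl)
      fix \<omega> assume "\<omega> \<in> space M"
      then show "?d (Suc N) \<omega> = ?d N \<omega> + indicator ?B \<omega> * (y (Suc N) \<omega> - y N \<omega>)"
        using S_le_T[of \<omega>]
        \<comment> \<open>The case \<open>N < S\<close> with \<open>T \<le> N\<close> is excluded by
          \<open>S \<le> T\<close>; the other three give increments 0, 0 and the full step.\<close>
        by (cases "enat N < S \<omega>"; cases "enat N < T \<omega>")
          (auto simp: at_time_min_Suc algebra_simps split: split_indicator)
    qed
    also have "\<dots> = integral\<^sup>L M (?d N) + (\<integral>\<omega>. indicator ?B \<omega> * (y (Suc N) \<omega> - y N \<omega>) \<partial>M)"
      by (intro Bochner_Integration.integral_add int integral_increment_le_0 B)
    finally show ?case
      using Suc integral_increment_le_0(2)[OF B] by linarith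
  qed
  then show ?thesis
    using integrable_indicator_stopped[OF S AM] integrable_indicator_stopped[OF T AM] by simp
qed

lemma optional_stopping_bounded:
  assumes N: "AE \<omega> in M. T \<omega> < enat N"
  shows "integrable M (at_time y T)"
    and "A \<in> sets (stopped_sigma F S) \<Longrightarrow>
      (\<integral>\<omega>\<in>A. at_time y T \<omega> \<partial>M) \<le> (\<integral>\<omega>\<in>A. at_time y S \<omega> \<partial>M)"
proof -
  \<comment> \<open>Both times are almost surely below \<open>N\<close>, so truncation at
    \<open>N\<close> changes neither stopped variable outside a null set and the truncated
    inequality carries over.\<close>
  have eqT: "AE \<omega> in M. at_time y (\<lambda>\<omega>. min (enat N) (T \<omega>)) \<omega> = at_time y T \<omega>"
    using N by eventually_elim (simp add: at_time_min_eq)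
  have eqS: "AE \<omega> in M. at_time y (\<lambda>\<omega>. min (enat N) (S \<omega>)) \<omega> = at_time y S \<omega>"
    using N AE_space
  proof eventually_elim
    case (elim \<omega>)
    then show ?case
      by (intro at_time_min_eq) (metis S_le_T le_less_trans less_imp_le)
  qed
  note meas[measurable] = measurable_stopped[OF S] measurable_stopped[OF T]
  show "integrable M (at_time y T)"
    by (rule integrable_cong_AE_imp[OF integrable_stopped[OF T] meas(2) eqT])
  assume A: "A \<in> sets (stopped_sigma F S)"
  then have [measurable]: "A \<in> sets M"
    using subalgebra_stopped[OF S] by (auto simp: subalgebra_def)
  have [measurable]: "at_time y (\<lambda>\<omega>. min (enat N) (T \<omega>)) \<in> borel_measurable M"
    "at_time y (\<lambda>\<omega>. min (enat N) (S \<omega>)) \<in> borel_measurable M"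
    by (intro borel_measurable_integrable integrable_stopped S T)+
  have "(\<integral>\<omega>. indicator A \<omega> * at_time y (\<lambda>\<omega>. min (enat N) (T \<omega>)) \<omega> \<partial>M) =
      (\<integral>\<omega>. indicator A \<omega> * at_time y T \<omega> \<partial>M)"
    using eqT by (intro integral_cong_AE) (measurable, auto)
  moreover have "(\<integral>\<omega>. indicator A \<omega> * at_time y (\<lambda>\<omega>. min (enat N) (S \<omega>)) \<omega> \<partial>M) =
      (\<integral>\<omega>. indicator A \<omega> * at_time y S \<omega> \<partial>M)"
    using eqS by (intro integral_cong_AE) (measurable, auto)
  ultimately show "(\<integral>\<omega>\<in>A. at_time y T \<omega> \<partial>M) \<le> (\<integral>\<omega>\<in>A. at_time y S \<omega> \<partial>M)"
    using integral_truncated_le[OF A, of N] by (simp add: set_lebesgue_integral_def)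
qed

end

section \<open>Optional stopping for nonnegative real supermartingales\<close>

lemma at_time_nonneg:
  assumes "\<And>n \<omega>. \<omega> \<in> space M \<Longrightarrow> 0 \<le> y n \<omega>" "\<omega> \<in> space M"
  shows "0 \<le> at_time y T \<omega>"
  using assms by (simp add: at_time_def split: enat.split)

lemma integrable_at_time_nonneg:
  assumes T: "nat_stopping_time F T" and fin: "AE \<omega> in M. T \<omega> < \<infinity>"
    and nonneg: "\<And>n \<omega>. \<omega> \<in> space M \<Longrightarrow> 0 \<le> y n \<omega>"
  shows "integrable M (at_time y T)"
proof (rule integral_le_of_AE_tendsto_nonneg(1))
  \<comment> \<open>The added 0 matches the offset in \<open>at_time_min_tendsto\<close>.\<close>
  let ?f = "\<lambda>n. at_time y (\<lambda>\<omega>. min (enat (n + 0)) (T \<omega>))"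
  show "integrable M (?f n)" for n
    by (rule integrable_stopped[OF T])
  show "AE \<omega> in M. 0 \<le> ?f n \<omega>" for n
    using nonneg by (intro AE_I2 at_time_nonneg)
  show "AE \<omega> in M. (\<lambda>n. ?f n \<omega>) \<longlonglongrightarrow> at_time y T \<omega>"
    using fin by eventually_elim (rule at_time_min_tendsto)
  show "at_time y T \<in> borel_measurable M"
    by (rule measurable_stopped[OF T])
  \<comment> \<open>Comparing \<open>T\<close> with the constant time 0 over the whole space bounds
    all truncated expectations by that of \<open>y 0\<close>, the constant needed for Fatou's
    lemma.\<close>
  have zero: "nat_stopping_time F (\<lambda>\<omega>. 0)"
    by (rule stopping_time_const)
  have "space M \<in> sets (stopped_sigma F (\<lambda>\<omega>. 0))"
    using sets.top[of "stopped_sigma F (\<lambda>\<omega>. 0)"] by (simp add: space_stopped_sigma)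
  note le = integral_truncated_le[OF zero T _ this]
  show "integral\<^sup>L M (?f n) \<le> integral\<^sup>L M (y 0)" for n
  proof -
    have "integral\<^sup>L M (?f n) = (\<integral>\<omega>. indicator (space M) \<omega> * ?f n \<omega> \<partial>M)"
      by (intro Bochner_Integration.integral_cong) auto
    also have "\<dots> \<le> (\<integral>\<omega>. indicator (space M) \<omega> * at_time y (\<lambda>\<omega>. min (enat n) 0) \<omega> \<partial>M)"
      using le[of n] by simp
    also have "\<dots> = integral\<^sup>L M (y 0)"
      by (intro Bochner_Integration.integral_cong) (auto simp: at_time_def zero_enat_def)
    finally show ?thesis .
  qed
qed

text \<open>Two limits in turn: for fixed \<open>k\<close> the truncation level tends to infinity by
  Fatou's lemma, then \<open>k\<close> tends to infinity by dominated convergence, both stopped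
  variables being integrable.\<close>

lemma optional_stopping_nonneg:
  assumes S: "nat_stopping_time F S" and T: "nat_stopping_time F T"
    and le: "\<And>\<omega>. \<omega> \<in> space M \<Longrightarrow> S \<omega> \<le> T \<omega>"
    and fin: "AE \<omega> in M. T \<omega> < \<infinity>"
    and nonneg: "\<And>n \<omega>. \<omega> \<in> space M \<Longrightarrow> 0 \<le> y n \<omega>"
    and A: "A \<in> sets (stopped_sigma F S)"
  shows "(\<integral>\<omega>\<in>A. at_time y T \<omega> \<partial>M) \<le> (\<integral>\<omega>\<in>A. at_time y S \<omega> \<partial>M)"
proof -
  have finS: "AE \<omega> in M. S \<omega> < \<infinity>"
    using fin AE_space by eventually_elim (metis le le_less_trans)
  have AM: "A \<in> sets M"
    using A subalgebra_stopped[OF S] by (auto simp: subalgebra_def)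
  define B where "B k = A \<inter> {\<omega> \<in> space M. S \<omega> \<le> enat k}" for k
  have B: "B k \<in> sets (stopped_sigma F S)" for k
  proof -
    have "{\<omega> \<in> space M. S \<omega> \<le> enat k} \<in> sets (stopped_sigma F S)"
      unfolding sets_stopped_sigma[OF filtration_axioms S]
    proof (intro CollectI conjI allI)
      show "{\<omega> \<in> space M. S \<omega> \<le> enat k} \<in> sigma_sets (space M) (\<Union>n. sets (F n))"
        using stopping_time_le_sets[OF S order_refl] by blast
      have "{\<omega> \<in> {\<omega> \<in> space M. S \<omega> \<le> enat k}. S \<omega> \<le> enat n} =
          {\<omega> \<in> space M. S \<omega> \<le> enat (min k n)}" for n
        by (auto simp flip: min_enat_simps(1))
      then show "{\<omega> \<in> {\<omega> \<in> space M. S \<omega> \<le> enat k}. S \<omega> \<le> enat n} \<in> sets (F n)" for n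
        using stopping_time_le_sets[OF S, of "min k n" n] by simp
    qed
    then show ?thesis
      unfolding B_def using A by auto
  qed
  have BM [measurable]: "B k \<in> sets M" for k
    using B subalgebra_stopped[OF S] by (auto simp: subalgebra_def)
  note [measurable] = measurable_stopped[OF S] measurable_stopped[OF T]
  have le_B: "(\<integral>\<omega>. indicator (B k) \<omega> * at_time y T \<omega> \<partial>M) \<le>
      (\<integral>\<omega>. indicator (B k) \<omega> * at_time y S \<omega> \<partial>M)" for k
  proof (rule integral_le_of_AE_tendsto_nonneg(2))
    let ?f = "\<lambda>n \<omega>. indicator (B k) \<omega> * at_time y (\<lambda>\<omega>. min (enat (n + k)) (T \<omega>)) \<omega>"
    show "integrable M (?f n)" for n
      by (rule integrable_indicator_stopped[OF T BM])
    show "AE \<omega> in M. 0 \<le> ?f n \<omega>" for n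
      using nonneg by (intro AE_I2 mult_nonneg_nonneg at_time_nonneg) auto
    show "AE \<omega> in M. (\<lambda>n. ?f n \<omega>) \<longlonglongrightarrow> indicator (B k) \<omega> * at_time y T \<omega>"
      using fin by eventually_elim (intro tendsto_mult_left at_time_min_tendsto)
    show "(\<lambda>\<omega>. indicator (B k) \<omega> * at_time y T \<omega>) \<in> borel_measurable M"
      by measurable
    \<comment> \<open>On \<open>B k\<close> the time \<open>S\<close> is at most \<open>k\<close>,
      so truncation at \<open>n + k\<close> does not affect it and the right-hand side is
      independent of \<open>n\<close>, as Fatou's lemma requires.\<close>
    have eq: "indicator (B k) \<omega> * at_time y (\<lambda>\<omega>. min (enat (n + k)) (S \<omega>)) \<omega> =
        indicator (B k) \<omega> * at_time y S \<omega>" for n \<omega>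
    proof (cases "\<omega> \<in> B k")
      case True
      then have "S \<omega> \<le> enat k"
        by (simp add: B_def)
      also have "enat k \<le> enat (n + k)"
        by simp
      finally show ?thesis
        by (simp add: at_time_min_eq)
    qed simp
    show "integral\<^sup>L M (?f n) \<le> (\<integral>\<omega>. indicator (B k) \<omega> * at_time y S \<omega> \<partial>M)" for n
      using integral_truncated_le[OF S T le B[of k], of "n + k"] unfolding eq .
  qed
  have lim: "(\<lambda>k. \<integral>\<omega>. indicator (B k) \<omega> * z \<omega> \<partial>M) \<longlonglongrightarrow> (\<integral>\<omega>. indicator A \<omega> * z \<omega> \<partial>M)"
    if z: "integrable M z" for z :: "'a \<Rightarrow> real"
  proof (rule integral_dominated_convergence)
    show "integrable M (\<lambda>\<omega>. \<bar>z \<omega>\<bar>)"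
      using z by simp
    show "(\<lambda>\<omega>. indicator A \<omega> * z \<omega>) \<in> borel_measurable M"
      "(\<lambda>\<omega>. indicator (B k) \<omega> * z \<omega>) \<in> borel_measurable M" for k
      using z AM by auto
    show "AE \<omega> in M. norm (indicator (B k) \<omega> * z \<omega>) \<le> \<bar>z \<omega>\<bar>" for k
      by (auto split: split_indicator)
    show "AE \<omega> in M. (\<lambda>k. indicator (B k) \<omega> * z \<omega>) \<longlonglongrightarrow> indicator A \<omega> * z \<omega>"
      using finS AE_space
    proof eventually_elim
      case (elim \<omega>)
      then obtain m where m: "S \<omega> = enat m"
        by auto
      \<comment> \<open>At a point with \<open>S = m\<close>, membership in \<open>B k\<close> and
        in \<open>A\<close> coincide from \<open>k = m\<close> on; finiteness of \<open>S\<close> is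
        essential here.\<close>
      have "\<forall>\<^sub>F k in sequentially. indicator (B k) \<omega> * z \<omega> = indicator A \<omega> * z \<omega>"
        using eventually_ge_at_top[of m]
        by eventually_elim (use elim in \<open>auto simp: B_def m split: split_indicator\<close>)
      then show ?case
        by (rule tendsto_eventually)
    qed
  qed
  have "(\<integral>\<omega>. indicator A \<omega> * at_time y T \<omega> \<partial>M) \<le> (\<integral>\<omega>. indicator A \<omega> * at_time y S \<omega> \<partial>M)"
    using le_B by (intro LIMSEQ_le[OF lim lim]
        integrable_at_time_nonneg[OF S finS nonneg] integrable_at_time_nonneg[OF T fin nonneg]) auto
  then show ?thesis
    by (simp add: set_lebesgue_integral_def)
qed

end

subsection \<open>Quadratic forms and the Loewner order\<close>

definition quad_form :: "real ^ 'd \<Rightarrow> real ^ 'd ^ 'd \<Rightarrow> real" where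
  "quad_form x A = x \<bullet> (A *v x)"

text \<open>In this shape the form is visibly linear in the matrix and polynomial in the vector,
  from which linearity, measurability and continuity are read off.\<close>

lemma quad_form_sum: "quad_form x A = (\<Sum>i\<in>UNIV. \<Sum>j\<in>UNIV. x $ i * x $ j * A $ i $ j)"
  by (simp add: quad_form_def inner_vec_def matrix_vector_mult_def sum_distrib_left ac_simps)

lemma quad_form_0 [simp]: "quad_form x 0 = 0"
  by (simp add: quad_form_sum)

lemma quad_form_diff: "quad_form x (A - B) = quad_form x A - quad_form x B"
  by (simp add: quad_form_sum right_diff_distrib sum_subtractf)

lemma measurable_quad_form:
  assumes "X \<in> borel_measurable M"
  shows "(\<lambda>\<omega>. quad_form x (X \<omega>)) \<in> borel_measurable M"
proof -
  have "continuous_on UNIV (quad_form x)"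
    unfolding quad_form_sum[abs_def] by (intro continuous_intros)
  from borel_measurable_continuous_on[OF this assms] show ?thesis .
qed

lemma sym_matrices_iff: "A \<in> sym_matrices \<longleftrightarrow> (\<forall>i j. A $ i $ j = A $ j $ i)"
  by (auto simp: sym_matrices_def vec_eq_iff transpose_def)

lemma sym_matrices_diff: "A \<in> sym_matrices \<Longrightarrow> B \<in> sym_matrices \<Longrightarrow> A - B \<in> sym_matrices"
  by (simp add: sym_matrices_iff)

lemma loewner_le_iff:
  assumes "A \<in> sym_matrices" "B \<in> sym_matrices"
  shows "A \<preceq>\<^sub>L B \<longleftrightarrow> (\<forall>x. quad_form x A \<le> quad_form x B)"
  using sym_matrices_diff[OF assms(2,1)]
  by (simp add: loewner_le_def psd_matrices_def quad_form_diff flip: quad_form_def)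

text \<open>Expanding the form at the sum of two unit vectors gives two diagonal entries and two
  equal cross terms. Integrability can thereby be passed from the forms back to the entries.\<close>

lemma quad_form_polarization:
  assumes "A \<in> sym_matrices"
  shows "A $ i $ j =
    (quad_form (axis i 1 + axis j 1) A - quad_form (axis i 1) A - quad_form (axis j 1) A) / 2"
proof -
  have "axis k 1 \<bullet> (A *v axis l 1) = A $ k $ l" for k l
    by (simp add: inner_axis' matrix_vector_mul_component inner_axis)
  moreover have "A $ j $ i = A $ i $ j"
    using assms by (simp add: sym_matrices_iff)
  ultimately show ?thesis
    by (simp add: quad_form_def matrix_vector_right_distrib inner_simps)
qed

lemma integrable_quad_form:
  "mat_integrable M X \<Longrightarrow> integrable M (\<lambda>\<omega>. quad_form x (X \<omega>))"
  by (simp add: quad_form_sum mat_integrable_def)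

lemma mat_integrableI_quad_form:
  assumes "\<And>x. integrable M (\<lambda>\<omega>. quad_form x (X \<omega>))"
    and "\<And>\<omega>. \<omega> \<in> space M \<Longrightarrow> X \<omega> \<in> sym_matrices"
  shows "mat_integrable M X"
  unfolding mat_integrable_def
proof (intro allI)
  fix i j
  have "integrable M (\<lambda>\<omega>. (quad_form (axis i 1 + axis j 1) (X \<omega>) -
      quad_form (axis i 1) (X \<omega>) - quad_form (axis j 1) (X \<omega>)) / 2)"
    using assms(1) by simp
  then show "integrable M (\<lambda>\<omega>. X \<omega> $ i $ j)"
    by (rule Bochner_Integration.integrable_cong[THEN iffD1, rotated 2])
      (use assms(2) in \<open>auto simp: quad_form_polarization[of _ i j]\<close>)
qed

lemma quad_form_mat_expectation:
  "mat_integrable M X \<Longrightarrow> quad_form x (mat_expectation M X) = (\<integral>\<omega>. quad_form x (X \<omega>) \<partial>M)"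
  by (simp add: quad_form_sum mat_expectation_def mat_integrable_def)

lemma mat_expectation_sym:
  assumes "\<And>\<omega>. \<omega> \<in> space M \<Longrightarrow> X \<omega> \<in> sym_matrices"
  shows "mat_expectation M X \<in> sym_matrices"
  using assms
  by (auto simp: sym_matrices_iff mat_expectation_def intro!: Bochner_Integration.integral_cong)

text \<open>A separate null set for each of uncountably many vectors is too much, but countably many
  are harmless. By continuity the vectors with a negative value form an open set, which if nonempty
  would meet the dense set \<open>D\<close>.\<close>

lemma AE_all_quad_form_nonneg:
  fixes W :: "'a \<Rightarrow> real ^ 'd ^ 'd"
  assumes "\<And>x. AE \<omega> in M. 0 \<le> quad_form x (W \<omega>)"
  shows "AE \<omega> in M. \<forall>x. 0 \<le> quad_form x (W \<omega>)"
proof -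
  obtain D :: "(real ^ 'd) set" where D: "countable D" "\<And>X. open X \<Longrightarrow> X \<noteq> {} \<Longrightarrow> \<exists>d\<in>D. d \<in> X"
    by (rule countable_dense_setE) blast
  have "AE \<omega> in M. \<forall>x\<in>D. 0 \<le> quad_form x (W \<omega>)"
    using assms D(1) by (simp add: AE_ball_countable)
  then show ?thesis
  proof eventually_elim
    case (elim \<omega>)
    have "open {x. quad_form x (W \<omega>) < 0}"
      unfolding quad_form_sum by (intro open_Collect_less continuous_intros)
    then have "{x. quad_form x (W \<omega>) < 0} = {}"
      using D(2)[of "{x. quad_form x (W \<omega>) < 0}"] elim by (force simp: not_le[symmetric])
    then show ?case
      by (auto simp: not_less)
  qed
qed

section \<open>Conditional expectations of random symmetric matrices\<close>

context sigma_finite_subalgebra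
begin

lemma quad_form_mat_cond_exp:
  assumes "mat_integrable M X"
  shows "AE \<omega> in M. real_cond_exp M F (\<lambda>\<omega>. quad_form x (X \<omega>)) \<omega> =
    quad_form x (mat_cond_exp M F X \<omega>)"
proof -
  have int: "integrable M (\<lambda>\<omega>. X \<omega> $ i $ j)" for i j
    using assms by (simp add: mat_integrable_def)
  \<comment> \<open>Linearity is applied in three layers: outer sum, inner sum, scalar factors. Each
    layer has only finitely many exceptional null sets.\<close>
  have "AE \<omega> in M. real_cond_exp M F (\<lambda>\<omega>. \<Sum>i\<in>UNIV. \<Sum>j\<in>UNIV. x $ i * x $ j * X \<omega> $ i $ j) \<omega> =
      (\<Sum>i\<in>UNIV. real_cond_exp M F (\<lambda>\<omega>. \<Sum>j\<in>UNIV. x $ i * x $ j * X \<omega> $ i $ j) \<omega>)"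
    by (rule real_cond_exp_sum) (simp add: int)
  moreover have "AE \<omega> in M. \<forall>i. real_cond_exp M F (\<lambda>\<omega>. \<Sum>j\<in>UNIV. x $ i * x $ j * X \<omega> $ i $ j) \<omega> =
      (\<Sum>j\<in>UNIV. real_cond_exp M F (\<lambda>\<omega>. x $ i * x $ j * X \<omega> $ i $ j) \<omega>)"
    by (intro eventually_all_finite real_cond_exp_sum) (simp add: int)
  moreover have "AE \<omega> in M. \<forall>i j. real_cond_exp M F (\<lambda>\<omega>. x $ i * x $ j * X \<omega> $ i $ j) \<omega> =
      x $ i * x $ j * real_cond_exp M F (\<lambda>\<omega>. X \<omega> $ i $ j) \<omega>"
    by (intro eventually_all_finite real_cond_exp_cmult int)
  ultimately show ?thesis
    by eventually_elim (simp add: quad_form_sum mat_cond_exp_def)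
qed

text \<open>Opposite entries are conditioned separately, so the versions chosen for them need only
  agree almost surely.\<close>

lemma mat_cond_exp_sym:
  assumes "mat_integrable M X" and sym: "\<And>\<omega>. \<omega> \<in> space M \<Longrightarrow> X \<omega> \<in> sym_matrices"
  shows "AE \<omega> in M. mat_cond_exp M F X \<omega> \<in> sym_matrices"
proof -
  have meas: "(\<lambda>\<omega>. X \<omega> $ i $ j) \<in> borel_measurable M" for i j
    using assms by (auto simp: mat_integrable_def)
  have "AE \<omega> in M. real_cond_exp M F (\<lambda>\<omega>. X \<omega> $ i $ j) \<omega> =
      real_cond_exp M F (\<lambda>\<omega>. X \<omega> $ j $ i) \<omega>" for i j
    using sym by (intro real_cond_exp_cong meas AE_I2) (auto simp: sym_matrices_iff)
  then have "AE \<omega> in M. \<forall>i j. real_cond_exp M F (\<lambda>\<omega>. X \<omega> $ i $ j) \<omega> =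
      real_cond_exp M F (\<lambda>\<omega>. X \<omega> $ j $ i) \<omega>"
    by (intro eventually_all_finite)
  then show ?thesis
    by eventually_elim (simp add: sym_matrices_iff mat_cond_exp_def)
qed

text \<open>The dictionary between matrix and scalar statements: symmetry reduces the Loewner order
  to quadratic forms, the dense-set argument moves the vector outside the almost sure quantifier,
  and linearity turns each form into a real conditional expectation.\<close>

lemma mat_cond_exp_le_iff:
  assumes X: "mat_integrable M X" "\<And>\<omega>. \<omega> \<in> space M \<Longrightarrow> X \<omega> \<in> sym_matrices"
    and Z: "mat_integrable M Z" "\<And>\<omega>. \<omega> \<in> space M \<Longrightarrow> Z \<omega> \<in> sym_matrices"
      "Z \<in> borel_measurable F"
  shows "(AE \<omega> in M. mat_cond_exp M F X \<omega> \<preceq>\<^sub>L Z \<omega>) \<longleftrightarrow>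
    (\<forall>x. \<forall>A\<in>sets F. (\<integral>\<omega>\<in>A. quad_form x (X \<omega>) \<partial>M) \<le> (\<integral>\<omega>\<in>A. quad_form x (Z \<omega>) \<partial>M))"
    (is "?L \<longleftrightarrow> ?R")
proof -
  have "AE \<omega> in M. mat_cond_exp M F X \<omega> \<in> sym_matrices"
    by (rule mat_cond_exp_sym) (fact X)+
  then have "?L \<longleftrightarrow> (AE \<omega> in M. \<forall>x. 0 \<le> quad_form x (Z \<omega> - mat_cond_exp M F X \<omega>))"
    using AE_space
    by (intro eventually_subst, eventually_elim) (simp add: loewner_le_iff Z quad_form_diff)
  also have "\<dots> \<longleftrightarrow> (\<forall>x. AE \<omega> in M. 0 \<le> quad_form x (Z \<omega> - mat_cond_exp M F X \<omega>))"
    using AE_all_quad_form_nonneg[where W = "\<lambda>\<omega>. Z \<omega> - mat_cond_exp M F X \<omega>"]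
    by (auto elim: eventually_mono)
  also have "\<dots> \<longleftrightarrow>
      (\<forall>x. AE \<omega> in M. real_cond_exp M F (\<lambda>\<omega>. quad_form x (X \<omega>)) \<omega> \<le> quad_form x (Z \<omega>))"
  proof (intro all_cong1 eventually_subst)
    show "AE \<omega> in M. 0 \<le> quad_form x (Z \<omega> - mat_cond_exp M F X \<omega>) \<longleftrightarrow>
        real_cond_exp M F (\<lambda>\<omega>. quad_form x (X \<omega>)) \<omega> \<le> quad_form x (Z \<omega>)" for x
      using quad_form_mat_cond_exp[OF X(1), of x] by eventually_elim (simp add: quad_form_diff)
  qed
  also have "\<dots> \<longleftrightarrow> ?R"
    by (simp add: real_cond_exp_le_iff integrable_quad_form X Z measurable_quad_form)
  finally show ?thesis .
qed

end

subsection \<open>Matrix supermartingales\<close>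

lemma (in prob_space) sigma_finite_subalgebraI:
  "subalgebra M G \<Longrightarrow> sigma_finite_subalgebra M G"
  by (intro finite_measure_subalgebra_is_sigma_finite)
    (simp add: finite_measure_subalgebra_def finite_measure_subalgebra_axioms_def
      finite_measure_axioms)

text \<open>Lets every stopping result be proved for real processes, one vector \<open>x\<close> at
  a time.\<close>

lemma (in prob_space) mat_supermartingale_iff:
  fixes Y :: "nat \<Rightarrow> 'a \<Rightarrow> real ^ 'd ^ 'd"
  shows "mat_supermartingale M F Y \<longleftrightarrow>
    (\<forall>x. real_supermartingale M F (\<lambda>n \<omega>. quad_form x (Y n \<omega>))) \<and>
    (\<forall>n. \<forall>\<omega>\<in>space M. Y n \<omega> \<in> sym_matrices) \<and> (\<forall>n. Y n \<in> borel_measurable (F n))"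
proof (safe)
  assume Y: "mat_supermartingale M F Y"
  then interpret filtration "space M" F
    by (simp add: mat_supermartingale_def)
  show "Y n \<omega> \<in> sym_matrices" if "\<omega> \<in> space M" for n \<omega>
    using Y that by (simp add: mat_supermartingale_def)
  show "Y n \<in> borel_measurable (F n)" for n
    using Y by (simp add: mat_supermartingale_def)
  fix x :: "real ^ 'd"
  show "real_supermartingale M F (\<lambda>n \<omega>. quad_form x (Y n \<omega>))"
  proof
    fix n A assume A: "A \<in> sets (F n)"
    interpret sigma_finite_subalgebra M "F n"
      using Y by (intro sigma_finite_subalgebraI) (simp add: mat_supermartingale_def)
    show "(\<integral>\<omega>\<in>A. quad_form x (Y (Suc n) \<omega>) \<partial>M) \<le> (\<integral>\<omega>\<in>A. quad_form x (Y n \<omega>) \<partial>M)"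
      using Y A mat_cond_exp_le_iff[of "Y (Suc n)" "Y n"] by (simp add: mat_supermartingale_def)
  qed (use Y in \<open>auto simp: mat_supermartingale_def integrable_quad_form measurable_quad_form\<close>)
next
  assume q: "\<forall>x. real_supermartingale M F (\<lambda>n \<omega>. quad_form x (Y n \<omega>))"
    and sym: "\<forall>n. \<forall>\<omega>\<in>space M. Y n \<omega> \<in> sym_matrices"
    and meas: "\<forall>n. Y n \<in> borel_measurable (F n)"
  \<comment> \<open>The filtration and subalgebra facts do not depend on the vector, so they are
    taken from the instance at 0.\<close>
  interpret zero: real_supermartingale M F "\<lambda>n \<omega>. quad_form 0 (Y n \<omega>)"
    using q by blast
  have int: "mat_integrable M (Y n)" for n
    using q sym by (intro mat_integrableI_quad_form) (auto intro: real_supermartingale.integrable)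
  have "AE \<omega> in M. mat_cond_exp M (F n) (Y (Suc n)) \<omega> \<preceq>\<^sub>L Y n \<omega>" for n
  proof -
    interpret sigma_finite_subalgebra M "F n"
      by (intro sigma_finite_subalgebraI zero.subalgebra)
    show ?thesis
      using q sym meas int mat_cond_exp_le_iff[of "Y (Suc n)" "Y n"]
      by (auto intro: real_supermartingale.set_integral_Suc_le)
  qed
  then show "mat_supermartingale M F Y"
    using sym meas int zero.subalgebra zero.filtration_axioms
    by (simp add: mat_supermartingale_def)
qed

text \<open>A smaller filtration leaves fewer sets to test, so only adaptedness to \<open>G\<close>
  has to be supplied. This treats the original and the stopped filtration at once.\<close>

lemma (in real_supermartingale) real_supermartingale_stopped:
  assumes T: "nat_stopping_time F T"
    and G: "filtration (space M) G" "\<And>n. sets (G n) \<subseteq> sets (F n)"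
    and meas: "\<And>n. at_time y (\<lambda>\<omega>. min (enat n) (T \<omega>)) \<in> borel_measurable (G n)"
  shows "real_supermartingale M G (\<lambda>n. at_time y (\<lambda>\<omega>. min (enat n) (T \<omega>)))"
proof -
  interpret G: filtration "space M" G
    by (rule G)
  show ?thesis
    using G(2) sets_F_subset
    by unfold_locales
      (auto simp: subalgebra_def G.space_F integrable_stopped[OF T] meas
        intro!: set_integral_stopped_Suc_le[OF T])
qed

section \<open>Stopping a matrix supermartingale\<close>

locale mat_supermartingale_space = prob_space M + nat_filtration "space M" F
  for M :: "'a measure" and F :: "nat \<Rightarrow> 'a measure" +
  fixes Y :: "nat \<Rightarrow> 'a \<Rightarrow> real ^ 'd ^ 'd"
  assumes mat_supermartingale: "mat_supermartingale M F Y"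
begin

lemma real_supermartingale_quad_form: "real_supermartingale M F (\<lambda>n \<omega>. quad_form x (Y n \<omega>))"
  using mat_supermartingale mat_supermartingale_iff by blast

lemma sym: "\<omega> \<in> space M \<Longrightarrow> Y n \<omega> \<in> sym_matrices"
  using mat_supermartingale by (simp add: mat_supermartingale_def)

lemma adapted: "Y n \<in> borel_measurable (F n)"
  using mat_supermartingale by (simp add: mat_supermartingale_def)

lemma sym_at_time: "\<omega> \<in> space M \<Longrightarrow> at_time Y T \<omega> \<in> sym_matrices"
  using sym by (auto simp: at_time_def split: enat.split) (simp add: sym_matrices_iff)

lemma quad_form_at_time: "quad_form x (at_time Y T \<omega>) = at_time (\<lambda>n \<omega>. quad_form x (Y n \<omega>)) T \<omega>"
  \<comment> \<open>A quadratic form vanishes at the zero matrix, so it respects the default value 0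
    at infinite times.\<close>
  by (simp add: at_time_compose[where f = "quad_form x"])

lemma mat_supermartingale_stoppedI:
  assumes T: "nat_stopping_time F T"
    and G: "filtration (space M) G" "\<And>n. sets (G n) \<subseteq> sets (F n)"
      "\<And>n. sets (stopped_sigma F (\<lambda>\<omega>. min (enat n) (T \<omega>))) \<subseteq> sets (G n)"
  shows "mat_supermartingale M G (\<lambda>n. at_time Y (\<lambda>\<omega>. min (enat n) (T \<omega>)))"
proof -
  interpret G: filtration "space M" G
    by (rule G)
  have meas: "at_time Y (\<lambda>\<omega>. min (enat n) (T \<omega>)) \<in> borel_measurable (G n)" for n
    by (rule measurable_from_subalg[OF _ measurable_at_time[OF stopping_time_min_enat[OF T] adapted]])
      (simp add: subalgebra_def space_stopped_sigma G.space_F G(3))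
  have "real_supermartingale M G
      (\<lambda>n \<omega>. quad_form x (at_time Y (\<lambda>\<omega>. min (enat n) (T \<omega>)) \<omega>))" for x
    using real_supermartingale.real_supermartingale_stopped[OF
        real_supermartingale_quad_form[of x] T G(1,2)] measurable_quad_form[OF meas, of x]
    by (simp add: quad_form_at_time)
  then show ?thesis
    unfolding mat_supermartingale_iff using meas sym_at_time by blast
qed

lemma mat_supermartingale_stopped:
  assumes T: "nat_stopping_time F T"
  shows "mat_supermartingale M F (\<lambda>n. at_time Y (\<lambda>\<omega>. min (enat n) (T \<omega>)))"
    and "mat_supermartingale M (\<lambda>n. stopped_sigma F (\<lambda>\<omega>. min (enat n) (T \<omega>)))
      (\<lambda>n. at_time Y (\<lambda>\<omega>. min (enat n) (T \<omega>)))"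
  by (rule mat_supermartingale_stoppedI[OF T];
      rule filtration_axioms filtration_stopped_sigma[OF T] stopped_sigma_min_subset[OF T] order_refl)+

text \<open>Bundles the alternatives (a) and (b) of the theorem, each with its condition on the time
  holding almost surely.\<close>

definition stoppable :: "('a \<Rightarrow> enat) \<Rightarrow> bool" where
  "stoppable T \<longleftrightarrow> (\<exists>N. AE \<omega> in M. T \<omega> < enat N) \<or>
    ((AE \<omega> in M. T \<omega> < \<infinity>) \<and> (\<forall>n. \<forall>\<omega>\<in>space M. Y n \<omega> \<in> psd_matrices))"

text \<open>Carries the hypothesis on the later time down to the earlier one, whose stopped variable
  must be integrable too.\<close>

lemma stoppable_mono:
  assumes "stoppable T" "\<And>\<omega>. \<omega> \<in> space M \<Longrightarrow> S \<omega> \<le> T \<omega>"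
  shows "stoppable S"
proof -
  have "AE \<omega> in M. S \<omega> < t" if "AE \<omega> in M. T \<omega> < t" for t
    using that AE_space by eventually_elim (metis assms(2) le_less_trans)
  then show ?thesis
    using assms(1) unfolding stoppable_def by blast
qed

lemma integrable_at_time:
  assumes T: "nat_stopping_time F T" and "stoppable T"
  shows "mat_integrable M (at_time Y T)"
proof (intro mat_integrableI_quad_form sym_at_time)
  fix x
  interpret q: real_supermartingale M F "\<lambda>n \<omega>. quad_form x (Y n \<omega>)"
    by (rule real_supermartingale_quad_form)
  from \<open>stoppable T\<close>
  have "integrable M (at_time (\<lambda>n \<omega>. quad_form x (Y n \<omega>)) T)"
    unfolding stoppable_def psd_matrices_def
    by (auto simp flip: quad_form_def
      intro: q.integrable_at_time_nonneg[OF T] q.optional_stopping_bounded(1)[OF T T])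
  then show "integrable M (\<lambda>\<omega>. quad_form x (at_time Y T \<omega>))"
    by (simp add: quad_form_at_time)
qed

context
  fixes S T :: "'a \<Rightarrow> enat"
  assumes S: "nat_stopping_time F S" and T: "nat_stopping_time F T"
    and S_le_T: "\<And>\<omega>. \<omega> \<in> space M \<Longrightarrow> S \<omega> \<le> T \<omega>"
    and stop: "stoppable T"
begin

lemma set_integral_quad_form_le:
  assumes A: "A \<in> sets (stopped_sigma F S)"
  shows "(\<integral>\<omega>\<in>A. quad_form x (at_time Y T \<omega>) \<partial>M) \<le> (\<integral>\<omega>\<in>A. quad_form x (at_time Y S \<omega>) \<partial>M)"
proof -
  interpret q: real_supermartingale M F "\<lambda>n \<omega>. quad_form x (Y n \<omega>)"
    by (rule real_supermartingale_quad_form)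
  from stop show ?thesis
    unfolding stoppable_def psd_matrices_def quad_form_at_time
    by (auto simp flip: quad_form_def intro: q.optional_stopping_nonneg[OF S T S_le_T _ _ A]
      q.optional_stopping_bounded(2)[OF S T S_le_T _ A])
qed

lemma optional_stopping:
  "AE \<omega> in M. mat_cond_exp M (stopped_sigma F S) (at_time Y T) \<omega> \<preceq>\<^sub>L at_time Y S \<omega>"
proof -
  interpret sigma_finite_subalgebra M "stopped_sigma F S"
    by (intro sigma_finite_subalgebraI real_supermartingale.subalgebra_stopped[OF
        real_supermartingale_quad_form] S)
  have "mat_integrable M (at_time Y S)" "mat_integrable M (at_time Y T)"
    using stoppable_mono[OF stop S_le_T] by (auto intro: integrable_at_time S T stop)
  then show ?thesis
    using measurable_at_time[OF S adapted] set_integral_quad_form_le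
    by (subst mat_cond_exp_le_iff) (auto intro: sym_at_time)
qed

lemma mat_expectation_at_time_le:
  "mat_expectation M (at_time Y T) \<preceq>\<^sub>L mat_expectation M (at_time Y S)"
proof -
  have "space M \<in> sets (stopped_sigma F S)"
    using sets.top[of "stopped_sigma F S"] by (simp add: space_stopped_sigma)
  then have "(\<integral>\<omega>. quad_form x (at_time Y T \<omega>) \<partial>M) \<le> (\<integral>\<omega>. quad_form x (at_time Y S \<omega>) \<partial>M)" for x
    using set_integral_quad_form_le[of "space M" x] integrable_at_time[OF S]
      integrable_at_time[OF T] stop stoppable_mono[OF stop S_le_T]
    by (simp add: set_integral_space integrable_quad_form)
  then show ?thesis
    by (simp add: loewner_le_iff mat_expectation_sym sym_at_time quad_form_mat_expectation
        integrable_at_time S T stop stoppable_mono[OF stop S_le_T])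
qed

end

end

theorem theorem3p3:
  fixes M :: "'a measure"
    and F :: "nat \<Rightarrow> 'a measure"
    and Y :: "nat \<Rightarrow> 'a \<Rightarrow> real ^ 'd ^ 'd"
    and \<sigma> \<tau> :: "'a \<Rightarrow> enat"
  assumes "prob_space M"
    and "mat_supermartingale M F Y"
    and "nat_stopping_time F \<sigma>"
    and "nat_stopping_time F \<tau>"
    and "\<And>\<omega>. \<omega> \<in> space M \<Longrightarrow> \<sigma> \<omega> \<le> \<tau> \<omega>"
  shows "mat_supermartingale M F (\<lambda>n. at_time Y (\<lambda>\<omega>. min (enat n) (\<tau> \<omega>))) \<and>
         mat_supermartingale M (\<lambda>n. stopped_sigma F (\<lambda>\<omega>. min (enat n) (\<tau> \<omega>)))
           (\<lambda>n. at_time Y (\<lambda>\<omega>. min (enat n) (\<tau> \<omega>))) \<and>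
         ((\<exists>N. AE \<omega> in M. \<tau> \<omega> < enat N) \<or>
         ((AE \<omega> in M. \<tau> \<omega> < \<infinity>) \<and> (\<forall>n. \<forall>\<omega>\<in>space M. Y n \<omega> \<in> psd_matrices)) \<longrightarrow>
         mat_integrable M (at_time Y \<tau>) \<and> mat_integrable M (at_time Y \<sigma>) \<and>
         (AE \<omega> in M. mat_cond_exp M (stopped_sigma F \<sigma>) (at_time Y \<tau>) \<omega> \<preceq>\<^sub>L at_time Y \<sigma> \<omega>) \<and>
         mat_expectation M (at_time Y \<tau>) \<preceq>\<^sub>L mat_expectation M (at_time Y \<sigma>) \<and>
         mat_expectation M (at_time Y \<sigma>) \<preceq>\<^sub>L mat_expectation M (Y 0))"
proof -
  interpret prob_space M
    by fact
  interpret mat_supermartingale_space M F Y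
    using assms(2) by unfold_locales (auto simp: mat_supermartingale_def filtration_def)
  note \<sigma> = assms(3) and \<tau> = assms(4) and le = assms(5)
  have "mat_integrable M (at_time Y \<tau>) \<and> mat_integrable M (at_time Y \<sigma>) \<and>
      (AE \<omega> in M. mat_cond_exp M (stopped_sigma F \<sigma>) (at_time Y \<tau>) \<omega> \<preceq>\<^sub>L at_time Y \<sigma> \<omega>) \<and>
      mat_expectation M (at_time Y \<tau>) \<preceq>\<^sub>L mat_expectation M (at_time Y \<sigma>) \<and>
      mat_expectation M (at_time Y \<sigma>) \<preceq>\<^sub>L mat_expectation M (Y 0)" if stop: "stoppable \<tau>"
  proof -
    note stop' = stoppable_mono[OF stop le]
    \<comment> \<open>The comparison with time 0 is the same expectation inequality for the pair
      consisting of the constant time 0 and \<sigma>.\<close>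
    have "at_time Y (\<lambda>\<omega>. 0) = Y 0"
      by (simp add: fun_eq_iff at_time_def zero_enat_def)
    with mat_expectation_at_time_le[OF stopping_time_const \<sigma> _ stop', of 0]
    have "mat_expectation M (at_time Y \<sigma>) \<preceq>\<^sub>L mat_expectation M (Y 0)"
      by simp
    then show ?thesis
      using integrable_at_time[OF \<tau> stop] integrable_at_time[OF \<sigma> stop']
        optional_stopping[OF \<sigma> \<tau> le stop] mat_expectation_at_time_le[OF \<sigma> \<tau> le stop]
      by blast
  qed
  then show ?thesis
    using mat_supermartingale_stopped[OF \<tau>] unfolding stoppable_def by blast
qed

end
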